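(* Let $p$ be a prime, let $G$ be a subgroup of $\mathbb{F}_p^*$, and let $g,h:G\to\mathbb{F}_p^*$ be arbitrary functions. Let $f(x,y)=g(x)(h(x)+y)$ for $(x,y)\in G\times\mathbb{F}_p^*$ and put $m=\mu(g\cdot h)$. Then for any sets $A\subset G$ and $B,C\subset\mathbb{F}_p^*$, $$|f(A,B)|\,|B\cdot C|\ge\frac18\min\left(\frac{|A||B|^2|C|}{pm^2},\frac{p|B|}{m}\right).$$
   Context: $\mathbb{F}_p$ is the field with $p$ elements and $\mathbb{F}_p^*=\mathbb{F}_p\setminus\{0\}$ its multiplicative group. For a function $\varphi:G\to\mathbb{F}_p$, $\mu(\varphi)=\max_{t\in\mathbb{F}_p}|\{x\in G:\varphi(x)=t\}|$. The function $g\cdot h$ is the pointwise product $x\mapsto g(x)h(x)$ on $G$. Further, $f(A,B)=\{f(a,b):(a,b)\in A\times B\}$ and $B\cdot C=\{bc: b\in B,\ c\in C\}$. *)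

theory Defs
  imports "HOL-Number_Theory.Residues" "HOL-Algebra.Coset" "HOL-Algebra.Multiplicative_Group"
begin

text \<open>
  The field with \<open>p\<close> elements is \<open>residue_ring (int p)\<close>, with carrier \<open>{0..int p - 1}\<close>;
  its multiplicative group is \<open>mult_of (residue_ring (int p))\<close>.
\<close>

abbreviation Fp :: "nat \<Rightarrow> int ring" where
  "Fp p \<equiv> residue_ring (int p)"

abbreviation Fp_star :: "nat \<Rightarrow> int monoid" where
  "Fp_star p \<equiv> mult_of (Fp p)"

definition mu :: "nat \<Rightarrow> int set \<Rightarrow> (int \<Rightarrow> int) \<Rightarrow> nat" where
  "mu p G \<phi> = Max ((\<lambda>t. card {x \<in> G. \<phi> x = t}) ` carrier (Fp p))"

end

theory Submission
  imports Defs "HOL-Analysis.Convex"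
begin

text \<open>
  The bound comes from counting incidences between points and lines in the plane over \<open>F\<^sub>p\<close>.
  If \<open>u = b c\<close> then \<open>g(x) (h(x) + b) = g(x) h(x) + (g(x) / c) u\<close>. Hence for fixed \<open>x \<in> A\<close> and
  \<open>c \<in> C\<close> the line with intercept \<open>g(x) h(x)\<close> and slope \<open>g(x) / c\<close> passes through the \<open>|B|\<close>
  distinct points \<open>(b c, f(x, b))\<close> of the grid \<open>P = (B \<cdot> C) \<times> f(A, B)\<close>. There are \<open>N = |A| |C|\<close> such
  lines, and each of them occurs for at most \<open>m = \<mu>(g \<cdot> h)\<close> pairs \<open>(x, c)\<close>: the intercept leaves at
  most \<open>m\<close> choices of \<open>x\<close>, and then the slope determines \<open>c\<close>.

  A small set \<open>P\<close> cannot be this rich. Let \<open>\<nu>\<close> count the pairs \<open>(x, c)\<close> whose line passes through a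
  given point. Two different lines meet at most once, so a second moment computation shows that
  \<open>\<nu>\<close> has mean \<open>N / p\<close> over the plane and squared deviation from it of total size at most
  \<open>m p N\<close> (lemma \<open>incidence_variance_le\<close>). On the other hand, the sum of \<open>\<nu>\<close> over \<open>P\<close> is at least
  \<open>N |B|\<close>; when \<open>|P| < p |B| / 2\<close>, this exceeds the expected value \<open>N |P| / p\<close> by at least
  \<open>N |B| / 2\<close>, and the Cauchy--Schwarz inequality on \<open>P\<close> gives
  \<open>N\<^sup>2 |B|\<^sup>2 / 4 \<le> m p N |P|\<close> (lemma \<open>card_rich_point_set_ge\<close>). Therefore
  \<open>|P| \<ge> min (|A| |B|\<^sup>2 |C| / (4 p m)) (p |B| / 2)\<close>, which implies the theorem because \<open>m \<ge> 1\<close> as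
  soon as \<open>A\<close> is nonempty.
\<close>

section \<open>The second moment of incidence counts\<close>

lemma sum_incidence_counts:
  fixes T :: "'i \<Rightarrow> 'a set"
  assumes "finite X" "finite I"
  shows "(\<Sum>x\<in>X. real (card {i \<in> I. x \<in> T i})) = (\<Sum>i\<in>I. real (card (T i \<inter> X)))"
proof -
  have "(\<Sum>x\<in>X. real (card {i \<in> I. x \<in> T i})) = (\<Sum>x\<in>X. \<Sum>i\<in>I. of_bool (x \<in> T i))"
    using assms(2) by (simp add: Int_def)
  also have "\<dots> = (\<Sum>i\<in>I. \<Sum>x\<in>X. of_bool (x \<in> T i))"
    by (rule sum.swap)
  also have "\<dots> = (\<Sum>i\<in>I. real (card (T i \<inter> X)))"
    using assms(1) by (simp add: Int_def conj_commute)
  finally show ?thesis .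
qed

text \<open>
  The square of the count at a point is the count of the pairs of sets through it, so this is the
  previous lemma for the family of pairwise intersections.
\<close>

lemma sum_incidence_counts_squared:
  fixes T :: "'i \<Rightarrow> 'a set"
  assumes "finite X" "finite I"
  shows "(\<Sum>x\<in>X. (real (card {i \<in> I. x \<in> T i}))\<^sup>2) =
           (\<Sum>i\<in>I. \<Sum>j\<in>I. real (card (T i \<inter> T j \<inter> X)))"
proof -
  have square: "(real (card {i \<in> I. x \<in> T i}))\<^sup>2 = real (card {k \<in> I \<times> I. x \<in> T (fst k) \<inter> T (snd k)})"
    for x
  proof -
    have "{k \<in> I \<times> I. x \<in> T (fst k) \<inter> T (snd k)} = {i \<in> I. x \<in> T i} \<times> {i \<in> I. x \<in> T i}"
      by auto
    then show ?thesis
      by (simp add: card_cartesian_product power2_eq_square)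
  qed
  show ?thesis
    unfolding square sum.cartesian_product case_prod_beta
    using assms by (intro sum_incidence_counts) auto
qed

text \<open>
  The sets \<open>T i\<close> behave like lines in a plane of order \<open>q\<close>. They are indexed, so that a line may
  be repeated, and \<open>m\<close> bounds the repetition: in a row of the double sum
  \<open>\<Sum>i j. |T i \<inter> T j|\<close> all but at most \<open>m\<close> terms are at most \<open>1\<close>, and the others are at most \<open>q\<close>. The bounds
  \<open>1\<close> add up to \<open>|I|\<^sup>2\<close>, which is exactly what subtracting the mean removes.
\<close>

lemma incidence_variance_le:
  fixes T :: "'i \<Rightarrow> 'a set" and q m :: nat
  assumes X: "finite X" "card X = q\<^sup>2" and I: "finite I" and q: "q > 0"
    and T: "\<And>i. i \<in> I \<Longrightarrow> T i \<subseteq> X" "\<And>i. i \<in> I \<Longrightarrow> card (T i) = q"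
    and few: "\<And>i. i \<in> I \<Longrightarrow> card {j \<in> I. card (T i \<inter> T j) > 1} \<le> m"
  shows "(\<Sum>x\<in>X. (real (card {i \<in> I. x \<in> T i}) - real (card I) / real q)\<^sup>2)
           \<le> real m * real q * real (card I)"
proof -
  let ?\<nu> = "\<lambda>x. real (card {i \<in> I. x \<in> T i})" and ?N = "real (card I)"
  have first: "(\<Sum>x\<in>X. ?\<nu> x) = ?N * real q"
    using T by (simp add: sum_incidence_counts X I Int_absorb2)
  have row: "(\<Sum>j\<in>I. real (card (T i \<inter> T j \<inter> X))) \<le> ?N + real m * real q" if i: "i \<in> I" for i
  proof -
    have "real (card (T i \<inter> T j \<inter> X)) \<le> 1 + real q * of_bool (card (T i \<inter> T j) > 1)" for j
    proof -
      have "T i \<inter> T j \<inter> X = T i \<inter> T j" and "card (T i \<inter> T j) \<le> card (T i)"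
        using T(1)[OF i] X(1) by (auto intro!: card_mono intro: finite_subset)
      then show ?thesis
        using T(2)[OF i] by auto
    qed
    then have "(\<Sum>j\<in>I. real (card (T i \<inter> T j \<inter> X)))
        \<le> (\<Sum>j\<in>I. 1 + real q * of_bool (card (T i \<inter> T j) > 1))"
      by (intro sum_mono)
    also have "\<dots> = ?N + real q * real (card {j \<in> I. card (T i \<inter> T j) > 1})"
      using I by (simp add: sum.distrib Int_def flip: sum_distrib_left)
    also have "\<dots> \<le> ?N + real q * real m"
      using few[OF i] by (intro add_left_mono mult_left_mono) auto
    finally show ?thesis by (simp add: mult.commute)
  qed
  have "(\<Sum>x\<in>X. (?\<nu> x)\<^sup>2) \<le> (\<Sum>i\<in>I. ?N + real m * real q)"
    unfolding sum_incidence_counts_squared[OF X(1) I] by (intro sum_mono row)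
  then have second: "(\<Sum>x\<in>X. (?\<nu> x)\<^sup>2) \<le> ?N\<^sup>2 + real m * real q * ?N"
    by (simp add: algebra_simps power2_eq_square)
  have "(\<Sum>x\<in>X. (?\<nu> x - ?N / real q)\<^sup>2) =
      (\<Sum>x\<in>X. (?\<nu> x)\<^sup>2) - 2 * (?N / real q) * (\<Sum>x\<in>X. ?\<nu> x) + real (card X) * (?N / real q)\<^sup>2"
    by (simp add: power2_diff sum.distrib sum_subtractf sum_distrib_left mult_ac)
  also have "\<dots> = (\<Sum>x\<in>X. (?\<nu> x)\<^sup>2) - ?N\<^sup>2"
    unfolding first X(2) using q by (simp add: field_simps power2_eq_square)
  finally show ?thesis
    using second by simp
qed

text \<open>
  If \<open>P\<close> has fewer than \<open>q b / 2\<close> points, the incidences with \<open>P\<close> expected on average are at most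
  half of the \<open>|I| b\<close> incidences that are there, and by the Cauchy--Schwarz inequality the
  variance bound forces \<open>P\<close> to be large.
\<close>

lemma card_rich_point_set_ge:
  fixes T :: "'i \<Rightarrow> 'a set" and q m b :: nat
  assumes X: "finite X" "card X = q\<^sup>2" and I: "finite I" and q: "q > 0" and m: "m > 0"
    and T: "\<And>i. i \<in> I \<Longrightarrow> T i \<subseteq> X" "\<And>i. i \<in> I \<Longrightarrow> card (T i) = q"
    and few: "\<And>i. i \<in> I \<Longrightarrow> card {j \<in> I. card (T i \<inter> T j) > 1} \<le> m"
    and P: "P \<subseteq> X" and rich: "\<And>i. i \<in> I \<Longrightarrow> b \<le> card (T i \<inter> P)"
  shows "real (card P) \<ge> min (real (card I) * (real b)\<^sup>2 / (4 * real q * real m)) (real q * real b / 2)"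
proof (cases "real (card P) \<ge> real q * real b / 2 \<or> I = {}")
  case True
  then show ?thesis by auto
next
  case False
  let ?\<nu> = "\<lambda>x. real (card {i \<in> I. x \<in> T i})" and ?N = "real (card I)"
  have fP: "finite P" using P X(1) by (rule finite_subset)
  have N: "?N > 0" using False I by (simp add: card_gt_0_iff)
  have "?N * real b = (\<Sum>i\<in>I. real b)" by simp
  also have "\<dots> \<le> (\<Sum>x\<in>P. ?\<nu> x)"
    unfolding sum_incidence_counts[OF fP I] using rich by (intro sum_mono) auto
  finally have inc: "?N * real b \<le> (\<Sum>x\<in>P. ?\<nu> x)" .
  have "real (card P) * (?N / real q) \<le> (real q * real b / 2) * (?N / real q)"
    using False by (intro mult_right_mono) auto
  also have "\<dots> = ?N * real b / 2" using q by simp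
  finally have "?N * real b / 2 \<le> (\<Sum>x\<in>P. ?\<nu> x - ?N / real q)"
    using inc by (simp add: sum_subtractf)
  then have "(?N * real b / 2)\<^sup>2 \<le> (\<Sum>x\<in>P. ?\<nu> x - ?N / real q)\<^sup>2"
    by (intro power_mono) auto
  also have "\<dots> \<le> (\<Sum>x\<in>P. (?\<nu> x - ?N / real q)\<^sup>2) * real (card P)"
    by (rule sum_squared_le_sum_of_squares)
  also have "\<dots> \<le> (\<Sum>x\<in>X. (?\<nu> x - ?N / real q)\<^sup>2) * real (card P)"
    using P X(1) by (intro mult_right_mono sum_mono2) auto
  also have "\<dots> \<le> (real m * real q * ?N) * real (card P)"
    by (intro mult_right_mono incidence_variance_le X I q T few) auto
  finally have "?N * (?N * (real b)\<^sup>2) \<le> ?N * (4 * real q * real m * real (card P))"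
    by (simp add: power2_eq_square algebra_simps)
  then have "?N * (real b)\<^sup>2 \<le> 4 * real q * real m * real (card P)"
    using N by simp
  then have "?N * (real b)\<^sup>2 / (4 * real q * real m) \<le> real (card P)"
    using q m by (simp add: pos_divide_le_eq mult.commute)
  then show ?thesis by simp
qed

section \<open>Lines over a field\<close>

definition (in ring) line :: "'a \<Rightarrow> 'a \<Rightarrow> ('a \<times> 'a) set" where
  "line s t = (\<lambda>u. (u, t \<oplus> s \<otimes> u)) ` carrier R"

lemma (in ring) card_line: "card (line s t) = card (carrier R)"
  unfolding line_def by (intro card_image inj_onI) auto

text \<open>
  Subtracting the equations of the two lines at abscissae \<open>u\<close> and \<open>v\<close> leaves
  \<open>(s - s') (u - v) = 0\<close>.
\<close>

lemma (in domain) lines_eq_if_meet_twice: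
  assumes car: "s \<in> carrier R" "t \<in> carrier R" "s' \<in> carrier R" "t' \<in> carrier R"
    and two: "card (line s t \<inter> line s' t') > 1"
  shows "s = s' \<and> t = t'"
proof -
  obtain P Q where PQ: "P \<in> line s t \<inter> line s' t'" "Q \<in> line s t \<inter> line s' t'" "P \<noteq> Q"
    using two card_le_Suc0_iff_eq[of "line s t \<inter> line s' t'"] card_ge_0_finite[of "line s t \<inter> line s' t'"]
    by (fastforce simp: not_le)
  then obtain u v where uv: "u \<in> carrier R" "v \<in> carrier R" "u \<noteq> v"
    and eu: "t \<oplus> s \<otimes> u = t' \<oplus> s' \<otimes> u" and ev: "t \<oplus> s \<otimes> v = t' \<oplus> s' \<otimes> v"
    unfolding line_def by auto
  have "(s \<ominus> s') \<otimes> (u \<ominus> v) =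
      (t \<oplus> s \<otimes> u) \<ominus> (t' \<oplus> s' \<otimes> u) \<ominus> ((t \<oplus> s \<otimes> v) \<ominus> (t' \<oplus> s' \<otimes> v))"
    using car uv(1,2) by algebra
  also have "\<dots> = \<zero>"
    using car uv(1,2) eu ev by (simp add: minus_eq r_neg)
  finally have "s \<ominus> s' = \<zero> \<or> u \<ominus> v = \<zero>"
    using car uv(1,2) integral_iff minus_closed by blast
  then have "s = s'"
    using car uv by (metis r_right_minus_eq)
  with eu car uv show ?thesis
    by simp
qed

text \<open>
  The expanding bound over an arbitrary finite field, where \<open>m\<close> bounds the fibres of
  \<open>g \<cdot> h\<close> on \<open>A\<close>. The lines are those with slope \<open>g(x) / c\<close> and intercept \<open>g(x) h(x)\<close>, and the
  rich set of points is \<open>(B \<cdot> C) \<times> F\<close>.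
\<close>

lemma (in field) card_image_times_card_product_ge:
  fixes g h :: "'i \<Rightarrow> 'a" and m :: nat
  assumes fin: "finite (carrier R)" "finite A" and m: "m > 0"
    and g: "\<And>x. x \<in> A \<Longrightarrow> g x \<in> carrier R - {\<zero>}"
    and h: "\<And>x. x \<in> A \<Longrightarrow> h x \<in> carrier R"
    and mult: "\<And>t. card {x \<in> A. g x \<otimes> h x = t} \<le> m"
    and B: "B \<subseteq> carrier R" and C: "C \<subseteq> carrier R - {\<zero>}"
    and F: "F = (\<lambda>(x, y). g x \<otimes> (h x \<oplus> y)) ` (A \<times> B)"
  shows "real (card F) * real (card (B <#> C)) \<ge>
    min (real (card A) * (real (card B))\<^sup>2 * real (card C) / (4 * real (card (carrier R)) * real m))
        (real (card (carrier R)) * real (card B) / 2)"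
proof -
  define T where "T = (\<lambda>(x, c). line (g x \<otimes> inv c) (g x \<otimes> h x))"
  have C_Units: "c \<in> Units R" "c \<in> carrier R" "inv c \<in> carrier R" if "c \<in> C" for c
    using C that by (auto simp: field_Units intro!: Units_inv_closed)
  have fin': "finite B" "finite C"
    using B C fin(1) by (auto intro: finite_subset)
  have "min (real (card (A \<times> C)) * (real (card B))\<^sup>2 / (4 * real (card (carrier R)) * real m))
        (real (card (carrier R)) * real (card B) / 2) \<le> real (card ((B <#> C) \<times> F))"
  proof (rule card_rich_point_set_ge[where X = "carrier R \<times> carrier R" and T = T])
    fix i assume "i \<in> A \<times> C"
    then obtain x c where i: "i = (x, c)" and x: "x \<in> A" and c: "c \<in> C"
      by auto
    note gx = g[OF x] h[OF x]
    show "T i \<subseteq> carrier R \<times> carrier R"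
      using gx C_Units[OF c] by (auto simp: T_def i line_def)
    show "card (T i) = card (carrier R)"
      by (simp add: T_def i card_line)
    \<comment> \<open>Lines that agree in two points have the same intercept, which puts \<open>fst j\<close> into a fibre
      of \<open>g \<cdot> h\<close>, and the same slope, from which \<open>snd j\<close> is recovered.\<close>
    have same: "g (fst j) \<otimes> h (fst j) = g x \<otimes> h x \<and> snd j = inv (inv (g (fst j)) \<otimes> (g x \<otimes> inv c))"
      if "j \<in> A \<times> C" "card (T i \<inter> T j) > 1" for j
    proof -
      from that(1) obtain y d where j: "j = (y, d)" and y: "y \<in> A" and d: "d \<in> C"
        by auto
      note gy = g[OF y] h[OF y]
      have "g x \<otimes> inv c = g y \<otimes> inv d \<and> g x \<otimes> h x = g y \<otimes> h y"
        using that(2) gx gy C_Units[OF c] C_Units[OF d]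
        by (intro lines_eq_if_meet_twice) (auto simp: T_def i j)
      moreover have "inv (g y) \<otimes> (g y \<otimes> inv d) = inv d"
      proof -
        have "g y \<in> Units R" using gy by (simp add: field_Units)
        then show ?thesis
          using C_Units[OF d] by (metis Units_closed Units_inv_closed Units_l_inv l_one m_assoc)
      qed
      ultimately show ?thesis
        using C_Units[OF d] by (simp add: j)
    qed
    have "card {j \<in> A \<times> C. card (T i \<inter> T j) > 1} \<le> card {y \<in> A. g y \<otimes> h y = g x \<otimes> h x}"
    proof (rule card_inj_on_le)
      show "inj_on fst {j \<in> A \<times> C. card (T i \<inter> T j) > 1}"
      proof (rule inj_onI)
        fix j k
        assume "j \<in> {j \<in> A \<times> C. card (T i \<inter> T j) > 1}" "k \<in> {j \<in> A \<times> C. card (T i \<inter> T j) > 1}"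
          and eq: "fst j = fst k"
        then have "snd j = snd k"
          using same[of j] same[of k] by simp
        with eq show "j = k"
          by (rule prod_eqI)
      qed
      show "fst ` {j \<in> A \<times> C. card (T i \<inter> T j) > 1} \<subseteq> {y \<in> A. g y \<otimes> h y = g x \<otimes> h x}"
        using same by fastforce
    qed (use fin in simp)
    then show "card {j \<in> A \<times> C. card (T i \<inter> T j) > 1} \<le> m"
      using mult by (rule order_trans)
    \<comment> \<open>The points \<open>(b c, g(x) (h(x) + b))\<close> are distinct for distinct \<open>b\<close> because \<open>c \<noteq> 0\<close>.\<close>
    show "card B \<le> card (T i \<inter> (B <#> C) \<times> F)"
    proof (rule card_inj_on_le[where f = "\<lambda>b. (b \<otimes> c, g x \<otimes> (h x \<oplus> b))"])
      show "inj_on (\<lambda>b. (b \<otimes> c, g x \<otimes> (h x \<oplus> b))) B"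
        using B C c by (intro inj_onI) (auto simp: m_rcancel subset_iff)
      show "finite (T i \<inter> (B <#> C) \<times> F)"
        using fin(1) by (auto simp: T_def i line_def)
      show "(\<lambda>b. (b \<otimes> c, g x \<otimes> (h x \<oplus> b))) ` B \<subseteq> T i \<inter> (B <#> C) \<times> F"
      proof clarify
        fix b assume b: "b \<in> B"
        then have b': "b \<in> carrier R" using B by auto
        have "inv c \<otimes> (b \<otimes> c) = b"
          using C_Units[OF c] b' by (metis m_comm m_assoc Units_r_inv r_one)
        then have "g x \<otimes> (h x \<oplus> b) = g x \<otimes> h x \<oplus> g x \<otimes> inv c \<otimes> (b \<otimes> c)"
          using gx b' C_Units[OF c] by (simp add: r_distr m_assoc)
        then have "(b \<otimes> c, g x \<otimes> (h x \<oplus> b)) \<in> T i"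
          using b' C_Units[OF c] by (auto simp: T_def i line_def)
        moreover have "g x \<otimes> (h x \<oplus> b) \<in> F"
          unfolding F by (rule image_eqI[of _ _ "(x, b)"]) (use x b in auto)
        moreover have "b \<otimes> c \<in> B <#> C"
          unfolding set_mult_def using b c by auto
        ultimately show "(b \<otimes> c, g x \<otimes> (h x \<oplus> b)) \<in> T i \<inter> (B <#> C) \<times> F"
          by blast
      qed
    qed
  next
    show "(B <#> C) \<times> F \<subseteq> carrier R \<times> carrier R"
      using B C g h unfolding F set_mult_def by (auto simp: subset_iff)
    have "carrier R \<noteq> {}" by auto
    then show "card (carrier R) > 0"
      using fin(1) by (simp add: card_gt_0_iff)
  qed (use fin fin' m in \<open>simp_all add: card_cartesian_product power2_eq_square\<close>)
  then show ?thesis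
    by (simp add: card_cartesian_product mult_ac)
qed

section \<open>The bound over the prime field\<close>

lemma card_fibre_le_mu:
  assumes "p > 0" "finite G" "A \<subseteq> G" and \<phi>: "\<And>x. x \<in> A \<Longrightarrow> \<phi> x \<in> carrier (Fp p)"
  shows "card {x \<in> A. \<phi> x = t} \<le> mu p G \<phi>"
proof (cases "t \<in> carrier (Fp p)")
  case True
  have "card {x \<in> A. \<phi> x = t} \<le> card {x \<in> G. \<phi> x = t}"
    using assms by (intro card_mono) auto
  also have "\<dots> \<le> mu p G \<phi>"
    unfolding mu_def using True by (intro Max_ge) (auto simp: residue_ring_def)
  finally show ?thesis .
next
  case False
  then have "{x \<in> A. \<phi> x = t} = {}" using \<phi> by auto
  then show ?thesis by (metis card.empty zero_le)
qed

theorem theorem2p2: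
  fixes p m :: nat
    and G A B C :: "int set"
    and g h :: "int \<Rightarrow> int"
    and f :: "int \<times> int \<Rightarrow> int"
  assumes "prime p"
    and "subgroup G (Fp_star p)"
    and "g \<in> G \<rightarrow> carrier (Fp_star p)"
    and "h \<in> G \<rightarrow> carrier (Fp_star p)"
    and "\<And>x y. x \<in> G \<Longrightarrow> y \<in> carrier (Fp_star p) \<Longrightarrow>
           f (x, y) = g x \<otimes>\<^bsub>Fp p\<^esub> (h x \<oplus>\<^bsub>Fp p\<^esub> y)"
    and "m = mu p G (\<lambda>x. g x \<otimes>\<^bsub>Fp p\<^esub> h x)"
    and "A \<subseteq> G"
    and "B \<subseteq> carrier (Fp_star p)"
    and "C \<subseteq> carrier (Fp_star p)"
  shows "real (card (f ` (A \<times> B))) * real (card (B <#>\<^bsub>Fp_star p\<^esub> C))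
    \<ge> 1 / 8 * min (real (card A) * real (card B) ^ 2 * real (card C) / (real p * real m ^ 2))
                  (real p * real (card B) / real m)"
proof (cases "A = {}")
  case True
  then show ?thesis by simp
next
  case False
  interpret residues_prime p "Fp p"
    using \<open>prime p\<close> by unfold_locales auto
  have card_carrier: "card (carrier (Fp p)) = p"
    by (simp add: residue_ring_def)
  have fin: "finite (carrier (Fp p))"
    by (simp add: residue_ring_def)
  have G: "G \<subseteq> carrier (Fp p)"
    using subgroup.subset[OF assms(2)] by auto
  have finG: "finite G" "finite A"
    using finite_subset[OF G fin] finite_subset[OF assms(7)] by auto
  have g: "g x \<in> carrier (Fp p) - {\<zero>\<^bsub>Fp p\<^esub>}" and h: "h x \<in> carrier (Fp p)" if "x \<in> A" for x
    using assms(3,4,7) that by (auto simp: Pi_iff)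
  have m_ge: "card {x \<in> A. g x \<otimes>\<^bsub>Fp p\<^esub> h x = t} \<le> m" for t
    unfolding assms(6)
    by (rule card_fibre_le_mu) (use assms(1,7) finG g h prime_gt_0_nat in auto)
  obtain a where "a \<in> A" using False by auto
  then have "card {x \<in> A. g x \<otimes>\<^bsub>Fp p\<^esub> h x = g a \<otimes>\<^bsub>Fp p\<^esub> h a} > 0"
    using finG by (auto simp: card_gt_0_iff)
  then have m: "m > 0"
    using m_ge[of "g a \<otimes>\<^bsub>Fp p\<^esub> h a"] by linarith
  have image: "f ` (A \<times> B) = (\<lambda>(x, y). g x \<otimes>\<^bsub>Fp p\<^esub> (h x \<oplus>\<^bsub>Fp p\<^esub> y)) ` (A \<times> B)"
    using assms(5,7,8) by (intro image_cong) auto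
  have prod: "B <#>\<^bsub>Fp_star p\<^esub> C = B <#>\<^bsub>Fp p\<^esub> C"
    by (simp add: set_mult_def)
  \<comment> \<open>The field bound \<open>min (X / (4 p m)) (Y / 2)\<close> is stronger than the one claimed, since \<open>m \<ge> 1\<close>.\<close>
  define X where "X = real (card A) * real (card B) ^ 2 * real (card C)"
  define Y where "Y = real p * real (card B)"
  have XY: "X \<ge> 0" "Y \<ge> 0" and m1: "real m \<ge> 1" and p: "real p > 0"
    using m assms(1) prime_gt_0_nat by (auto simp: X_def Y_def)
  have "min (X / (4 * real p * real m)) (Y / 2) \<le> real (card (f ` (A \<times> B))) * real (card (B <#>\<^bsub>Fp_star p\<^esub> C))"
    unfolding X_def Y_def prod
    by (rule card_image_times_card_product_ge[OF fin finG(2) m g h m_ge _ _ image, unfolded card_carrier])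
      (use assms(8,9) in auto)
  moreover have "1 / 8 * (X / (real p * real m ^ 2)) \<le> X / (4 * real p * real m)"
  proof -
    have "X / (8 * real p * real m ^ 2) \<le> X / (4 * real p * real m)"
      using XY m1 p by (intro divide_left_mono) (auto simp: power2_eq_square)
    then show ?thesis by simp
  qed
  moreover have "1 / 8 * (Y / real m) \<le> Y / 2"
  proof -
    have "Y / (8 * real m) \<le> Y / 2"
      using XY m1 by (intro divide_left_mono) auto
    then show ?thesis by simp
  qed
  ultimately show ?thesis
    unfolding X_def[symmetric] Y_def[symmetric] by linarith
qed

end
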